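(* In LP$^{\mathrm{MLN}}$ (i.e. with respect to semi-strong equivalence $\equiv_{s,s}$), the S-AD transformation is both SE-preserving and NSE-preserving.
   Context: Atoms are propositional. A rule $r$ is an expression $h_1\vee\cdots\vee h_k\leftarrow b_1,\dots,b_m,\mathit{not}\,c_1,\dots,\mathit{not}\,c_n$; write $H(r)$, $B^+(r)$, $B^-(r)$ for the sets of head, positive body and negative body atoms. A program is a finite set of rules. An interpretation $X$ satisfies $r$ iff $X\cap H(r)\neq\emptyset$ or $B^+(r)\not\subseteq X$ or $B^-(r)\cap X\neq\emptyset$. GL-reduct $P^X=\{H(r)\leftarrow B^+(r) : r\in P,\ B^-(r)\cap X=\emptyset\}$; $X$ is an ASP stable model of $P$ iff $X\models P^X$ and no proper subset of $X$ satisfies $P^X$. Weights of LP$^{\mathrm{MLN}}$ rules are omitted; $X$ is an LP$^{\mathrm{MLN}}$ stable model of $P$ iff $X$ is an ASP stable model of $\{r\in P: X\models r\}$. $P\equiv_{s,s}Q$ iff for every program $R$, $P\cup R$ and $Q\cup R$ have the same LP$^{\mathrm{MLN}}$ stable models. Programs are regarded as tuples of rules; $\langle P,Q\rangle$ is the concatenation. For a tuple $T=\langle r_1,\dots,r_n\rangle$ with atom set $at(T)$, let $\langle S_1,\dots,S_{3n}\rangle=\langle H(r_1),B^+(r_1),B^-(r_1),\dots,H(r_n),B^+(r_n),B^-(r_n)\rangle$; for nonempty $N'\subseteq\{1,\dots,3n\}$ the independent set is $I_{N'}=\bigcap_{i\in N'}S_i\setminus\bigcup_{j\notin N'}S_j$.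 The S-AD transformation takes an independent set $I_{N'}$ with $|I_{N'}|\ge 2$ and a fresh atom $a'\notin at(T)$ and adds $a'$ to each $S_i$ with $i\in N'$. For a pair $T=\langle P,Q\rangle$ the result is $\langle P^+,Q^+\rangle$ with $P^+$ the first $|P|$ rules. A transformation type is SE-preserving if for every pair $\langle P,Q\rangle$ and every admissible application $P\equiv_{s,s}Q$ implies $P^+\equiv_{s,s}Q^+$, and NSE-preserving if $P\not\equiv_{s,s}Q$ implies $P^+\not\equiv_{s,s}Q^+$. *)

theory Defs
  imports Main "HOL-Library.FSet"
begin

datatype 'a rule = Rule (head: "'a fset") (pos: "'a fset") (neg: "'a fset")

definition sat_rule :: "'a set \<Rightarrow> 'a rule \<Rightarrow> bool" where
  "sat_rule X r \<longleftrightarrow>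
     X \<inter> fset (head r) \<noteq> {} \<or> \<not> fset (pos r) \<subseteq> X \<or> fset (neg r) \<inter> X \<noteq> {}"

definition sat :: "'a set \<Rightarrow> 'a rule set \<Rightarrow> bool" where
  "sat X P \<longleftrightarrow> (\<forall>r\<in>P. sat_rule X r)"

definition reduct :: "'a rule set \<Rightarrow> 'a set \<Rightarrow> 'a rule set" where
  "reduct P X = {Rule (head r) (pos r) {||} | r. r \<in> P \<and> fset (neg r) \<inter> X = {}}"

definition asp_stable :: "'a rule set \<Rightarrow> 'a set \<Rightarrow> bool" where
  "asp_stable P X \<longleftrightarrow> sat X (reduct P X) \<and> \<not> (\<exists>Y. Y \<subset> X \<and> sat Y (reduct P X))"

definition lpmln_stable :: "'a rule set \<Rightarrow> 'a set \<Rightarrow> bool" where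
  "lpmln_stable P X \<longleftrightarrow> asp_stable {r \<in> P. sat_rule X r} X"

definition semi_strong_equiv :: "'a rule set \<Rightarrow> 'a rule set \<Rightarrow> bool" where
  "semi_strong_equiv P Q \<longleftrightarrow>
     (\<forall>R. finite R \<longrightarrow> (\<forall>X. lpmln_stable (P \<union> R) X \<longleftrightarrow> lpmln_stable (Q \<union> R) X))"

text \<open>
  From here on programs are tuples (lists) of rules. The component sets are numbered from \<open>0\<close>:
  for the \<open>k\<close>-th rule \<open>r\<close>, the sets \<open>H(r)\<close>, \<open>B\<^sup>+(r)\<close>, \<open>B\<^sup>-(r)\<close> have
  numbers \<open>3k\<close>, \<open>3k + 1\<close>, \<open>3k + 2\<close>.
\<close>

definition components :: "'a rule list \<Rightarrow> 'a fset list" where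
  "components T = concat (map (\<lambda>r. [head r, pos r, neg r]) T)"

definition atoms :: "'a rule list \<Rightarrow> 'a set" where
  "atoms T = (\<Union>r\<in>set T. fset (head r) \<union> fset (pos r) \<union> fset (neg r))"

definition independent_set :: "'a rule list \<Rightarrow> nat set \<Rightarrow> 'a set" where
  "independent_set T N =
     (\<Inter>i\<in>N. fset (components T ! i)) -
     (\<Union>j\<in>{..<3 * length T} - N. fset (components T ! j))"

definition add_atom :: "nat set \<Rightarrow> 'a \<Rightarrow> 'a rule list \<Rightarrow> 'a rule list" where
  "add_atom N a T =
     (let add = (\<lambda>i S. if i \<in> N then finsert a S else S)
      in map (\<lambda>k. Rule (add (3 * k) (head (T ! k)))
                       (add (3 * k + 1) (pos (T ! k)))
                       (add (3 * k + 2) (neg (T ! k))))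
             [0..<length T])"

text \<open>
  A transformation type is the relation between a pair of programs and the pairs that result
  from its admissible applications.
\<close>

type_synonym 'a transformation =
  "'a rule list \<times> 'a rule list \<Rightarrow> 'a rule list \<times> 'a rule list \<Rightarrow> bool"

definition S_AD :: "'a transformation" where
  "S_AD = (\<lambda>(P, Q) (P', Q').
     \<exists>N a. N \<noteq> {} \<and> N \<subseteq> {..<3 * length (P @ Q)} \<and>
           card (independent_set (P @ Q) N) \<ge> 2 \<and>
           a \<notin> atoms (P @ Q) \<and>
           P' = take (length P) (add_atom N a (P @ Q)) \<and>
           Q' = drop (length P) (add_atom N a (P @ Q)))"

definition SE_preserving :: "'a transformation \<Rightarrow> bool" where
  "SE_preserving tr \<longleftrightarrow>
     (\<forall>P Q P' Q'. tr (P, Q) (P', Q') \<longrightarrow>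
        semi_strong_equiv (set P) (set Q) \<longrightarrow> semi_strong_equiv (set P') (set Q'))"

definition NSE_preserving :: "'a transformation \<Rightarrow> bool" where
  "NSE_preserving tr \<longleftrightarrow>
     (\<forall>P Q P' Q'. tr (P, Q) (P', Q') \<longrightarrow>
        \<not> semi_strong_equiv (set P) (set Q) \<longrightarrow> \<not> semi_strong_equiv (set P') (set Q'))"

end

theory Submission imports Defs begin

text \<open>
  Semi-strong equivalence is equality of SE-models, the pairs \<open>(Y, X)\<close> with \<open>Y \<subseteq> X\<close> such that \<open>Y\<close>
  satisfies the reduct by \<open>X\<close> of the rules that \<open>X\<close> satisfies. Whether \<open>(Y, X)\<close> is an SE-model
  depends on each component set \<open>S\<close> only through the tests \<open>S \<inter> Z = {}\<close> and \<open>S \<subseteq> Z\<close> for \<open>Z\<close>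
  among \<open>X\<close> and \<open>Y\<close>. Two atoms \<open>b \<noteq> c\<close> of the independent set and the new atom \<open>a\<close> occur in the
  same components after the transformation, so the tests see the three atoms only through the
  disjunction and the conjunction of their truth values, and \<open>b\<close> and \<open>c\<close> alone can realise any
  such pair of values. This gives monotone maps of interpretations in both directions that
  preserve all tests, hence SE-models.
\<close>

section \<open>SE-models\<close>

definition se_models :: "'a rule set \<Rightarrow> ('a set \<times> 'a set) set" where
  "se_models P = {(Y, X). Y \<subseteq> X \<and> sat Y (reduct {r \<in> P. sat_rule X r} X)}"

definition breaks :: "'a rule \<Rightarrow> 'a set \<Rightarrow> 'a set \<Rightarrow> bool" where
  "breaks r Y X \<longleftrightarrow> fset (neg r) \<inter> X = {} \<and> fset (pos r) \<subseteq> Y \<and>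
     fset (head r) \<inter> Y = {} \<and> fset (head r) \<inter> X \<noteq> {}"

lemma mem_se_models_iff: "(Y, X) \<in> se_models P \<longleftrightarrow> Y \<subseteq> X \<and> (\<forall>r\<in>P. \<not> breaks r Y X)"
proof -
  have sat: "sat Y (reduct {r \<in> P. sat_rule X r} X) \<longleftrightarrow>
      (\<forall>r\<in>P. sat_rule X r \<and> fset (neg r) \<inter> X = {} \<longrightarrow> sat_rule Y (Rule (head r) (pos r) {||}))"
    unfolding sat_def reduct_def by blast
  have "breaks r Y X \<longleftrightarrow> sat_rule X r \<and> fset (neg r) \<inter> X = {} \<and>
      \<not> sat_rule Y (Rule (head r) (pos r) {||})" if "Y \<subseteq> X" for r
    using that by (auto simp: sat_rule_def breaks_def)
  then show ?thesis
    by (auto simp: se_models_def sat)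
qed

lemma se_models_refl: "(X, X) \<in> se_models P"
  by (auto simp: mem_se_models_iff breaks_def)

lemma se_models_Un: "se_models (P \<union> Q) = se_models P \<inter> se_models Q"
  by (auto simp: mem_se_models_iff)

lemma se_models_eqI:
  assumes "\<And>Y X. Y \<subseteq> X \<Longrightarrow> (Y, X) \<in> se_models P \<longleftrightarrow> (Y, X) \<in> se_models Q"
  shows "se_models P = se_models Q"
  using assms by (auto simp: mem_se_models_iff)

lemma lpmln_stable_iff_se_models: "lpmln_stable P X \<longleftrightarrow> (\<forall>Y. (Y, X) \<in> se_models P \<longrightarrow> Y = X)"
  using se_models_refl[of X P]
  by (auto simp: lpmln_stable_def asp_stable_def se_models_def)

section \<open>Transfer of SE-models along maps of components\<close>

definition rule_components :: "'a rule \<Rightarrow> 'a fset list" where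
  "rule_components r = [head r, pos r, neg r]"

definition map_components :: "('a fset \<Rightarrow> 'b fset) \<Rightarrow> 'a rule \<Rightarrow> 'b rule" where
  "map_components h r = Rule (h (head r)) (h (pos r)) (h (neg r))"

definition tests_alike :: "'a set \<Rightarrow> 'a set \<Rightarrow> 'b set \<Rightarrow> 'b set \<Rightarrow> bool" where
  "tests_alike S Z T W \<longleftrightarrow> (S \<inter> Z = {} \<longleftrightarrow> T \<inter> W = {}) \<and> (S \<subseteq> Z \<longleftrightarrow> T \<subseteq> W)"

lemma length_rule_components [simp]: "length (rule_components r) = 3"
  by (simp add: rule_components_def)

lemma map_components_id [simp]: "map_components id = id"
  by (simp add: fun_eq_iff map_components_def)

lemma tests_alike_Un:
  assumes "tests_alike S Z T W" "tests_alike S' Z T' W"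
  shows "tests_alike (S \<union> S') Z (T \<union> T') W"
  using assms by (simp add: tests_alike_def Int_Un_distrib2)

lemma breaks_map_components_iff:
  assumes "\<And>S. S \<in> set (rule_components r) \<Longrightarrow>
    tests_alike (fset (h S)) Y' (fset S) Y \<and> tests_alike (fset (h S)) X' (fset S) X"
  shows "breaks (map_components h r) Y' X' \<longleftrightarrow> breaks r Y X"
  using assms by (simp add: breaks_def map_components_def rule_components_def tests_alike_def)

lemma se_models_map_components_iff:
  assumes "Y' \<subseteq> X'" "Y \<subseteq> X"
    and "\<And>r S. r \<in> P \<Longrightarrow> S \<in> set (rule_components r) \<Longrightarrow>
      tests_alike (fset (h S)) Y' (fset S) Y \<and> tests_alike (fset (h S)) X' (fset S) X"
  shows "(Y', X') \<in> se_models (map_components h ` P) \<longleftrightarrow> (Y, X) \<in> se_models P"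
proof -
  have "breaks (map_components h r) Y' X' \<longleftrightarrow> breaks r Y X" if "r \<in> P" for r
    using assms(3)[OF that] by (rule breaks_map_components_iff)
  then show ?thesis
    using assms(1,2) by (simp add: mem_se_models_iff)
qed

lemma finite_atoms: "finite (atoms T)"
  by (simp add: atoms_def)

lemma component_subset_atoms:
  assumes "r \<in> set T" "S \<in> set (rule_components r)"
  shows "fset S \<subseteq> atoms T"
  using assms by (auto simp: atoms_def rule_components_def)

lemma se_models_Int_atoms_iff:
  assumes "P \<subseteq> set T" "Y \<subseteq> X"
  shows "(Y \<inter> atoms T, X \<inter> atoms T) \<in> se_models P \<longleftrightarrow> (Y, X) \<in> se_models P"
proof -
  have "tests_alike (fset S) (Z \<inter> atoms T) (fset S) Z"
    if "r \<in> P" "S \<in> set (rule_components r)" for r S Z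
    using component_subset_atoms[of r T S] that assms(1) by (auto simp: tests_alike_def)
  then have "(Y \<inter> atoms T, X \<inter> atoms T) \<in> se_models (map_components id ` P) \<longleftrightarrow>
      (Y, X) \<in> se_models P"
    using assms(2) by (intro se_models_map_components_iff) auto
  then show ?thesis
    by simp
qed

section \<open>Semi-strong equivalence\<close>

definition separator :: "'a set \<Rightarrow> 'a set \<Rightarrow> 'a rule set" where
  "separator Y X = (\<lambda>x. Rule {|x|} {||} {||}) ` Y \<union>
     (\<lambda>(x, y). Rule {|x|} {|y|} {||}) ` ((X - Y) \<times> (X - Y))"

lemma finite_separator:
  assumes "finite X" "Y \<subseteq> X"
  shows "finite (separator Y X)"
  using assms by (auto simp: separator_def finite_subset)

lemma se_models_separator_iff:
  assumes "Y \<subseteq> X"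
  shows "(Z, X) \<in> se_models (separator Y X) \<longleftrightarrow> Z = Y \<or> Z = X"
proof -
  have "(Z, X) \<in> se_models (separator Y X) \<longleftrightarrow>
      Y \<subseteq> Z \<and> Z \<subseteq> X \<and> (\<forall>x\<in>X - Y. \<forall>y\<in>X - Y. y \<in> Z \<longrightarrow> x \<in> Z)"
    using assms by (force simp: mem_se_models_iff separator_def breaks_def ball_Un)
  also have "\<dots> \<longleftrightarrow> Z = Y \<or> Z = X"
    using assms by blast
  finally show ?thesis .
qed

lemma lpmln_stable_separator_iff:
  assumes "Y \<subset> X"
  shows "lpmln_stable (P \<union> separator Y X) X \<longleftrightarrow> (Y, X) \<notin> se_models P"
  using assms
  by (auto simp: lpmln_stable_iff_se_models se_models_Un se_models_separator_iff)

lemma semi_strong_equiv_imp_se_models_iff: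
  assumes "semi_strong_equiv P Q" "finite X"
  shows "(Y, X) \<in> se_models P \<longleftrightarrow> (Y, X) \<in> se_models Q"
proof -
  consider (not_subset) "\<not> Y \<subseteq> X" | (equal) "Y = X" | (proper) "Y \<subset> X"
    by blast
  then show ?thesis
  proof cases
    case proper
    then have "finite (separator Y X)"
      using \<open>finite X\<close> by (intro finite_separator) auto
    then have "lpmln_stable (P \<union> separator Y X) X \<longleftrightarrow> lpmln_stable (Q \<union> separator Y X) X"
      using assms(1) by (simp add: semi_strong_equiv_def)
    then show ?thesis
      using proper by (simp add: lpmln_stable_separator_iff)
  qed (simp_all add: mem_se_models_iff[of Y] se_models_refl)
qed

lemma semi_strong_equiv_iff_se_models:
  assumes "finite P" "finite Q"
  shows "semi_strong_equiv P Q \<longleftrightarrow> se_models P = se_models Q"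
proof
  assume equiv: "semi_strong_equiv P Q"
  obtain T where T: "set T = P \<union> Q"
    using assms finite_list[of "P \<union> Q"] by blast
  show "se_models P = se_models Q"
  proof (rule se_models_eqI)
    fix Y X :: "'a set"
    assume "Y \<subseteq> X"
    have "(Y, X) \<in> se_models P \<longleftrightarrow> (Y \<inter> atoms T, X \<inter> atoms T) \<in> se_models P"
      using se_models_Int_atoms_iff[of P T] T \<open>Y \<subseteq> X\<close> by blast
    also have "\<dots> \<longleftrightarrow> (Y \<inter> atoms T, X \<inter> atoms T) \<in> se_models Q"
      using equiv by (rule semi_strong_equiv_imp_se_models_iff) (simp add: finite_atoms)
    also have "\<dots> \<longleftrightarrow> (Y, X) \<in> se_models Q"
      using se_models_Int_atoms_iff[of Q T] T \<open>Y \<subseteq> X\<close> by blast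
    finally show "(Y, X) \<in> se_models P \<longleftrightarrow> (Y, X) \<in> se_models Q" .
  qed
next
  assume "se_models P = se_models Q"
  then show "semi_strong_equiv P Q"
    by (simp add: semi_strong_equiv_def lpmln_stable_iff_se_models se_models_Un)
qed

lemma semi_strong_equiv_map_components_iff:
  assumes "finite P" "finite Q" "mono pull" "mono push"
    and pull: "\<And>r S Z. r \<in> P \<union> Q \<Longrightarrow> S \<in> set (rule_components r) \<Longrightarrow>
      tests_alike (fset (h S)) Z (fset S) (pull Z)"
    and push: "\<And>r S Z. r \<in> P \<union> Q \<Longrightarrow> S \<in> set (rule_components r) \<Longrightarrow>
      tests_alike (fset (h S)) (push Z) (fset S) Z"
  shows "semi_strong_equiv (map_components h ` P) (map_components h ` Q) \<longleftrightarrow>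
    semi_strong_equiv P Q"
proof -
  have pull_iff: "(Y, X) \<in> se_models (map_components h ` R) \<longleftrightarrow> (pull Y, pull X) \<in> se_models R"
    if "Y \<subseteq> X" "R \<subseteq> P \<union> Q" for Y X R
  proof (rule se_models_map_components_iff)
    show "pull Y \<subseteq> pull X"
      using \<open>mono pull\<close> \<open>Y \<subseteq> X\<close> by (rule monoD)
  qed (use that pull in blast)+
  have push_iff: "(push Y, push X) \<in> se_models (map_components h ` R) \<longleftrightarrow> (Y, X) \<in> se_models R"
    if "Y \<subseteq> X" "R \<subseteq> P \<union> Q" for Y X R
  proof (rule se_models_map_components_iff)
    show "push Y \<subseteq> push X"
      using \<open>mono push\<close> \<open>Y \<subseteq> X\<close> by (rule monoD)
  qed (use that push in blast)+
  have "se_models (map_components h ` P) = se_models (map_components h ` Q) \<longleftrightarrow>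
      se_models P = se_models Q"
  proof
    assume same: "se_models (map_components h ` P) = se_models (map_components h ` Q)"
    show "se_models P = se_models Q"
    proof (rule se_models_eqI)
      show "(Y, X) \<in> se_models P \<longleftrightarrow> (Y, X) \<in> se_models Q" if "Y \<subseteq> X" for Y X
        using same push_iff[OF that, of P] push_iff[OF that, of Q] by simp
    qed
  next
    assume "se_models P = se_models Q"
    then show "se_models (map_components h ` P) = se_models (map_components h ` Q)"
      by (intro se_models_eqI) (simp add: pull_iff)
  qed
  then show ?thesis
    using \<open>finite P\<close> \<open>finite Q\<close> by (simp add: semi_strong_equiv_iff_se_models)
qed

section \<open>Copying an atom\<close>

definition copy_atom :: "'a \<Rightarrow> 'a \<Rightarrow> 'a fset \<Rightarrow> 'a fset" where
  "copy_atom b a S = (if b |\<in>| S then finsert a S else S)"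

definition contract_interp :: "'a \<Rightarrow> 'a \<Rightarrow> 'a \<Rightarrow> 'a set \<Rightarrow> 'a set" where
  "contract_interp b c a Z =
     {x. if x = b then {a, b, c} \<inter> Z \<noteq> {} else if x = c then {a, b, c} \<subseteq> Z else x \<in> Z}"

lemma mono_contract_interp: "mono (contract_interp b c a)"
  by (rule monoI) (simp add: contract_interp_def subset_iff)

lemma fset_copy_atom:
  assumes "a |\<notin>| S"
  shows "fset (copy_atom b a S) = id(a := b) -` fset S"
  using assms by (auto simp: copy_atom_def split: if_splits)

lemma tests_alike_vimage:
  assumes "S \<subseteq> range f"
  shows "tests_alike (f -` S) (f -` Z) S Z"
  using assms by (auto simp: tests_alike_def)

lemma tests_alike_copy_atom_vimage:
  assumes "a |\<notin>| S"
  shows "tests_alike (fset (copy_atom b a S)) (id(a := b) -` Z) (fset S) Z"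
proof -
  have "fset S \<subseteq> range (id(a := b))"
    using assms by (auto simp: image_iff)
  then show ?thesis
    unfolding fset_copy_atom[OF assms] by (rule tests_alike_vimage)
qed

lemma tests_alike_copy_atom_contract_interp:
  assumes "b |\<in>| S \<longleftrightarrow> c |\<in>| S" "b \<noteq> c"
  shows "tests_alike (fset (copy_atom b a S)) Z (fset S) (contract_interp b c a Z)"
proof -
  have others: "tests_alike (fset S - {b, c}) Z (fset S - {b, c}) (contract_interp b c a Z)"
    by (auto simp: tests_alike_def contract_interp_def)
  have triple: "tests_alike {a, b, c} Z {b, c} (contract_interp b c a Z)"
    using \<open>b \<noteq> c\<close> by (auto simp: tests_alike_def contract_interp_def)
  show ?thesis
  proof (cases "b |\<in>| S")
    case True
    then have "fset (copy_atom b a S) = {a, b, c} \<union> (fset S - {b, c})"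
        "fset S = {b, c} \<union> (fset S - {b, c})"
      using assms by (auto simp: copy_atom_def)
    then show ?thesis
      using tests_alike_Un[OF triple others] by simp
  next
    case False
    then show ?thesis
      using others assms by (simp add: copy_atom_def)
  qed
qed

lemma semi_strong_equiv_copy_atom_iff:
  assumes "finite P" "finite Q" "b \<noteq> c"
    and "\<And>r S. r \<in> P \<union> Q \<Longrightarrow> S \<in> set (rule_components r) \<Longrightarrow> a |\<notin>| S"
    and "\<And>r S. r \<in> P \<union> Q \<Longrightarrow> S \<in> set (rule_components r) \<Longrightarrow> b |\<in>| S \<longleftrightarrow> c |\<in>| S"
  shows "semi_strong_equiv (map_components (copy_atom b a) ` P) (map_components (copy_atom b a) ` Q)
    \<longleftrightarrow> semi_strong_equiv P Q"
proof (rule semi_strong_equiv_map_components_iff)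
  show "mono (contract_interp b c a)"
    by (rule mono_contract_interp)
  show "mono (vimage (id(a := b)))"
    by (intro monoI vimage_mono)
  fix r S Z
  assume "r \<in> P \<union> Q" "S \<in> set (rule_components r)"
  with assms(4,5) have fresh: "a |\<notin>| S" and twins: "b |\<in>| S \<longleftrightarrow> c |\<in>| S"
    by blast+
  show "tests_alike (fset (copy_atom b a S)) Z (fset S) (contract_interp b c a Z)"
    using twins \<open>b \<noteq> c\<close> by (rule tests_alike_copy_atom_contract_interp)
  show "tests_alike (fset (copy_atom b a S)) (id(a := b) -` Z) (fset S) Z"
    using fresh by (rule tests_alike_copy_atom_vimage)
qed (use assms in auto)

section \<open>The S-AD transformation\<close>

lemma nth_components:
  assumes "k < length T" "i < 3"
  shows "components T ! (3 * k + i) = rule_components (T ! k) ! i"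
  using assms(1)
proof (induction T arbitrary: k)
  case (Cons r T)
  have "components (r # T) = rule_components r @ components T"
    by (simp add: components_def rule_components_def)
  then show ?case
    using Cons \<open>i < 3\<close> by (cases k) (simp_all add: nth_append)
qed simp

lemma independent_set_mem_nth_iff:
  assumes "b \<in> independent_set T N" "k < length T" "i < 3"
  shows "b |\<in>| rule_components (T ! k) ! i \<longleftrightarrow> 3 * k + i \<in> N"
proof -
  have "3 * k + i < 3 * length T"
    using assms(2,3) by linarith
  then show ?thesis
    using assms(1) by (auto simp: independent_set_def simp flip: nth_components[OF assms(2,3)])
qed

lemma independent_set_mem_component_iff:
  assumes "b \<in> independent_set T N" "c \<in> independent_set T N"
    and "r \<in> set T" "S \<in> set (rule_components r)"
  shows "b |\<in>| S \<longleftrightarrow> c |\<in>| S"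
proof -
  obtain k where "k < length T" "r = T ! k"
    using assms(3) by (auto simp: in_set_conv_nth)
  moreover obtain i where "i < 3" "S = rule_components r ! i"
    using assms(4) by (auto simp: in_set_conv_nth)
  ultimately show ?thesis
    using assms(1,2) by (simp add: independent_set_mem_nth_iff)
qed

lemma add_atom_eq_map_copy_atom:
  assumes "b \<in> independent_set T N"
  shows "add_atom N a T = map (map_components (copy_atom b a)) T"
proof (rule nth_equalityI)
  fix k
  assume "k < length (add_atom N a T)"
  then have k: "k < length T"
    by (simp add: add_atom_def Let_def)
  note mem_iff = independent_set_mem_nth_iff[OF assms k]
  show "add_atom N a T ! k = map (map_components (copy_atom b a)) T ! k"
    using k mem_iff[of 0] mem_iff[of 1] mem_iff[of 2]
    by (simp add: add_atom_def map_components_def copy_atom_def rule_components_def)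
qed (simp add: add_atom_def Let_def)

lemma semi_strong_equiv_S_AD_iff:
  assumes "S_AD (P, Q) (P', Q')"
  shows "semi_strong_equiv (set P') (set Q') \<longleftrightarrow> semi_strong_equiv (set P) (set Q)"
proof -
  obtain N a where two: "card (independent_set (P @ Q) N) \<ge> 2" and fresh: "a \<notin> atoms (P @ Q)"
    and parts: "P' = take (length P) (add_atom N a (P @ Q))"
      "Q' = drop (length P) (add_atom N a (P @ Q))"
    using assms unfolding S_AD_def prod.case by blast
  obtain D where D: "D \<subseteq> independent_set (P @ Q) N" "card D = 2"
    by (rule obtain_subset_with_card_n[OF two])
  then obtain b c where "D = {b, c}" "b \<noteq> c"
    by (auto simp: card_2_iff)
  with D(1) have bc: "b \<in> independent_set (P @ Q) N" "c \<in> independent_set (P @ Q) N"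
    by simp_all
  have images: "set P' = map_components (copy_atom b a) ` set P"
      "set Q' = map_components (copy_atom b a) ` set Q"
    by (simp_all add: parts add_atom_eq_map_copy_atom[OF bc(1)])
  have new: "a |\<notin>| S" if "r \<in> set P \<union> set Q" "S \<in> set (rule_components r)" for r S
    using that fresh component_subset_atoms[of r "P @ Q" S] by auto
  have twins: "b |\<in>| S \<longleftrightarrow> c |\<in>| S"
    if "r \<in> set P \<union> set Q" "S \<in> set (rule_components r)" for r S
    using that by (intro independent_set_mem_component_iff[OF bc]) simp_all
  show ?thesis
    unfolding images
    using finite_set finite_set \<open>b \<noteq> c\<close> new twins by (rule semi_strong_equiv_copy_atom_iff)
qed

theorem theorem5:
  "SE_preserving (S_AD :: 'a transformation) \<and> NSE_preserving (S_AD :: 'a transformation)"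
  unfolding SE_preserving_def NSE_preserving_def using semi_strong_equiv_S_AD_iff by blast

end
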